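(* Let $s,t$ be arbitrary (complex, or indeterminate) parameters. For all integers $n\ge0$ and $0\le k\le n$, the second-order $(s,t)$-Eulerian numbers $E^{(2)}_{(s,t)}(n,k)$ satisfy $$E^{(2)}_{(s,t)}(n,k)=\frac1{k!}\sum_{r=0}^k\binom{k}{r}(s+t+2n)^{\underline{k-r}}\sum_{p=0}^r\binom{r}{p}(-1)^{k-p}\sum_{j=0}^p\binom{p}{j}(s+t)^{\overline{j}}\,(s+j)\,(p+s)^{n+r-j-1}.$$
   Context: The second-order $(s,t)$-Eulerian numbers (the case $\nu=2$ of the $\nu$-order $(s,t)$-Eulerian numbers) are defined by $$E^{(2)}_{(s,t)}(n,k)=(k+s)\,E^{(2)}_{(s,t)}(n-1,k)+(2n-k+t-1)\,E^{(2)}_{(s,t)}(n-1,k-1)+\delta_{k0}\delta_{n0},$$ with $E^{(2)}_{(s,t)}(n,k)=0$ if $n<0$ or $k<0$. They are polynomials in $s,t$, and $s,t$ are treated as indeterminate parameters. Notation: $x^{\overline{j}}=x(x+1)\cdots(x+j-1)$ and $x^{\underline{j}}=x(x-1)\cdots(x-j+1)$ are the raising and falling factorials (equal to $1$ for $j=0$). Conventions: $0^0=1$; a negative exponent occurs only for $n=k=0$ (with $r=p=j=0$), where the product $(s+j)(p+s)^{n+r-j-1}=s\cdot s^{-1}$ is read as $1$, also when $s=0$. *)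

theory Defs
  imports Complex_Main
begin

(* The indices are integers, so that the recurrence can be used as it stands
   with the value 0 outside n, k >= 0. *)
function eulerian2 :: "'a::field_char_0 \<Rightarrow> 'a \<Rightarrow> int \<Rightarrow> int \<Rightarrow> 'a" where
  "eulerian2 s t n k =
     (if n < 0 \<or> k < 0 then 0
      else (of_int k + s) * eulerian2 s t (n - 1) k
         + (of_int (2 * n - k) + t - 1) * eulerian2 s t (n - 1) (k - 1)
         + (if k = 0 then 1 else 0) * (if n = 0 then 1 else 0))"
  by pat_completeness auto
termination
  by (relation "Wellfounded.measure (\<lambda>(s, t, n, k). nat (n + 1))") auto

(* The defining equation loops as a rewrite rule. *)
declare eulerian2.simps [simp del]

definition falling_factorial :: "'a::comm_ring_1 \<Rightarrow> nat \<Rightarrow> 'a" where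
  "falling_factorial x j = (\<Prod>i<j. x - of_nat i)"

(* (s + j) (p + s)^e for an integer exponent e, with 0^0 = 1.  If e is negative and
   p + s = 0, the product is read as 1.  In the explicit formula for 0 <= k <= n a negative
   exponent occurs only for n = k = 0, as s s^(-1), so that s = 0 is the only such case. *)
definition power_factor :: "'a::field_char_0 \<Rightarrow> nat \<Rightarrow> nat \<Rightarrow> int \<Rightarrow> 'a" where
  "power_factor s j p e =
     (if e < 0 \<and> of_nat p + s = 0 then 1 else (s + of_nat j) * (of_nat p + s) powi e)"

end

theory Submission
  imports Defs "HOL-Computational_Algebra.Formal_Power_Series"
begin

text \<open>
  Write \<open>a = s + t\<close> and let \<open>F\<^sub>n(x)\<close> be the generating polynomial of the \<open>n\<close>-th row of
  the numbers. The recurrence says that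
  \<open>F\<^sub>n\<^sub>+\<^sub>1 = x (1 - x) F\<^sub>n' + (s + (2 n + t) x) F\<^sub>n\<close>.
  Dividing by powers of \<open>1 - x\<close> removes the part of this that depends on \<open>n\<close>: for
  \<open>G\<^sub>n = F\<^sub>n / (1 - x)\<^sup>a\<^sup>+\<^sup>2\<^sup>n\<close> it becomes \<open>(1 - x) G\<^sub>n\<^sub>+\<^sub>1 = x G\<^sub>n' + s G\<^sub>n\<close>, with
  \<open>G\<^sub>0 = (1 - x)\<^sup>-\<^sup>a\<close>. The exponential coefficients \<open>A(n,r)\<close> of \<open>G\<^sub>n\<close> are therefore
  characterised by
  \<open>A(n+1,r) = r A(n+1,r-1) + (r+s) A(n,r)\<close> and \<open>A(0,r) = a (a+1) \<dots> (a+r-1)\<close>.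

  The two inner sums of the explicit formula are a closed form of \<open>A(n,r)\<close>, as an \<open>r\<close>-th
  finite difference in \<open>p\<close> (\<open>weighted_power_difference\<close>). The terms of this difference depend
  on \<open>n\<close> and \<open>r\<close> only through \<open>n + r\<close>, up to binomial coefficients, and are multiplied by
  \<open>p + s\<close> when \<open>n + r\<close> grows by one; this gives the recurrence. The initial values
  come from the vanishing of the \<open>m\<close>-th finite difference on polynomials of degree less
  than \<open>m\<close>: after exchanging sums it kills everything except the term \<open>j = r\<close>.
  The outer sum of the formula is the Cauchy product \<open>F\<^sub>n = (1 - x)\<^sup>a\<^sup>+\<^sup>2\<^sup>n G\<^sub>n\<close>.
\<close>

section \<open>Finite differences of powers\<close>

text \<open>The induction lowers the degree by splitting one factor \<open>x + i\<close> into \<open>x\<close> and \<open>i\<close>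
  and absorbing the \<open>i\<close> into the binomial coefficient.\<close>

lemma alternating_binomial_sum_power_eq_0:
  fixes x :: "'a::comm_ring_1"
  assumes "d < m"
  shows "(\<Sum>i\<le>m. of_nat (m choose i) * (-1) ^ i * (x + of_nat i) ^ d) = 0"
  using assms
proof (induction d arbitrary: m x)
  case 0
  then show ?case
    using choose_alternating_sum[of m, where 'a='a] by (simp add: mult.commute)
next
  case (Suc d)
  then obtain l where m: "m = Suc l" and "d < l" by (cases m) auto
  have absorbed: "(\<Sum>i\<le>m. of_nat (m choose i) * (-1) ^ i * (of_nat i * (x + of_nat i) ^ d)) =
      - of_nat m * (\<Sum>i\<le>l. of_nat (l choose i) * (-1) ^ i * ((x + 1) + of_nat i) ^ d)"
  proof -
    have "of_nat (Suc l choose Suc i) * (-1) ^ Suc i * (of_nat (Suc i) * (x + of_nat (Suc i)) ^ d) =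
        - of_nat (Suc l) * (of_nat (l choose i) * (-1) ^ i * ((x + 1) + of_nat i) ^ d)" for i
    proof -
      have "of_nat (Suc i) * of_nat (Suc l choose Suc i) = (of_nat (Suc l) * of_nat (l choose i) :: 'a)"
        using Suc_times_binomial_eq[of l i] by (metis of_nat_mult mult.commute)
      then have "(-1) ^ Suc i * (x + of_nat (Suc i)) ^ d * (of_nat (Suc i) * of_nat (Suc l choose Suc i))
        = (-1) ^ Suc i * (x + of_nat (Suc i)) ^ d * (of_nat (Suc l) * of_nat (l choose i))" by simp
      then show ?thesis by (simp add: mult_ac add_ac del: binomial_Suc_Suc of_nat_Suc) (simp add: add_ac)
    qed
    then show ?thesis
      unfolding m by (subst sum.atMost_Suc_shift) (simp add: sum_distrib_left del: of_nat_Suc binomial_Suc_Suc)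
  qed
  have "(\<Sum>i\<le>m. of_nat (m choose i) * (-1) ^ i * (x + of_nat i) ^ Suc d) =
      x * (\<Sum>i\<le>m. of_nat (m choose i) * (-1) ^ i * (x + of_nat i) ^ d) +
      (\<Sum>i\<le>m. of_nat (m choose i) * (-1) ^ i * (of_nat i * (x + of_nat i) ^ d))"
    by (simp add: sum_distrib_left flip: sum.distrib) (simp add: algebra_simps)
  also have "\<dots> = 0"
    using Suc.IH[of m x] Suc.IH[of l "x + 1"] Suc.prems \<open>d < l\<close> absorbed by simp
  finally show ?case .
qed

section \<open>The inner sums of the explicit formula\<close>

text \<open>The innermost sum, where \<open>N\<close> stands for \<open>n + r\<close>: it depends on \<open>n\<close> and \<open>r\<close> in no other
  way.\<close>

definition weighted_power_sum :: "'a::field_char_0 \<Rightarrow> 'a \<Rightarrow> nat \<Rightarrow> nat \<Rightarrow> 'a" where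
  "weighted_power_sum a s N p =
    (\<Sum>j=0..p. of_nat (p choose j) * pochhammer a j * power_factor s j p (int N - int j - 1))"

definition weighted_power_difference :: "'a::field_char_0 \<Rightarrow> 'a \<Rightarrow> nat \<Rightarrow> nat \<Rightarrow> 'a" where
  "weighted_power_difference a s n r =
    (\<Sum>p=0..r. of_nat (r choose p) * (-1) ^ (r - p) * weighted_power_sum a s (n + r) p)"

lemma power_factor_nonneg:
  "power_factor s j p (int e) = (s + of_nat j) * (of_nat p + s) ^ e"
  by (simp add: power_factor_def)

text \<open>For \<open>p \<le> N\<close> the only negative exponent in \<open>weighted_power_sum a s N p\<close> is \<open>-1\<close>, and it
  occurs for \<open>j = p = N\<close>, where the base is the
  weight \<open>s + j\<close> itself; so the value 1 is right whether or not the base vanishes.\<close>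

lemma power_factor_diagonal_minus_1:
  "power_factor s p p (-1) = 1"
  by (simp add: power_factor_def power_int_minus add.commute)

lemma power_factor_Suc:
  assumes "j \<le> p" "p \<le> N"
  shows "power_factor s j p (int (Suc N) - int j - 1) =
    (of_nat p + s) * power_factor s j p (int N - int j - 1)"
proof (cases "j < N")
  case True
  then have "int (Suc N) - int j - 1 = int (Suc (N - j - 1))" "int N - int j - 1 = int (N - j - 1)"
    by auto
  then show ?thesis by (simp only: power_factor_nonneg) simp
next
  case False
  then have "j = p" "N = p" using assms by auto
  then show ?thesis
    using power_factor_nonneg[of s p p 0] by (simp add: power_factor_diagonal_minus_1 add.commute)
qed

lemma weighted_power_sum_Suc:
  assumes "p \<le> N"
  shows "weighted_power_sum a s (Suc N) p = (of_nat p + s) * weighted_power_sum a s N p"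
  unfolding weighted_power_sum_def sum_distrib_left
  by (rule sum.cong[OF refl], subst power_factor_Suc) (use assms in auto)

text \<open>For \<open>r > 0\<close> both differences on the right are over the same values \<open>weighted_power_sum a s (n + r) p\<close>.
  Since \<open>r (r-1 choose p) = (r - p) (r choose p)\<close>, the coefficients combine to
  \<open>(r choose p) ((r + s) - (r - p)) = (r choose p) (p + s)\<close>.\<close>

lemma weighted_power_difference_Suc:
  "weighted_power_difference a s (Suc n) r =
    of_nat r * weighted_power_difference a s (Suc n) (r - 1) +
    (of_nat r + s) * weighted_power_difference a s n r"
proof (cases r)
  case 0
  then show ?thesis by (simp add: weighted_power_difference_def weighted_power_sum_Suc)
next
  case (Suc q)
  let ?W = "weighted_power_sum a s (n + r)"
  have "of_nat r * weighted_power_difference a s (Suc n) q =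
      (\<Sum>p=0..q. of_nat r * (of_nat (q choose p) * (-1) ^ (q - p) * ?W p))"
    by (simp add: weighted_power_difference_def sum_distrib_left Suc)
  \<comment> \<open>The new summand \<open>p = r\<close> vanishes.\<close>
  also have "\<dots> = (\<Sum>p=0..r. - (of_nat (r - p) * of_nat (r choose p) * (-1) ^ (r - p) * ?W p))"
  proof -
    have "of_nat r * (of_nat (q choose p) * (-1) ^ (q - p) * ?W p) =
        - (of_nat (r - p) * of_nat (r choose p) * (-1) ^ (r - p) * ?W p)" if "p \<le> q" for p
    proof -
      have "r * (q choose p) = (r - p) * (r choose p)"
        using binomial_absorb_comp[of r p] Suc by simp
      then have "of_nat r * of_nat (q choose p) = (of_nat (r - p) * of_nat (r choose p) :: 'a)"
        by (metis of_nat_mult)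
      moreover have "(-1) ^ (r - p) = - ((-1) ^ (q - p) :: 'a)"
        using that by (simp add: Suc Suc_diff_le)
      ultimately show ?thesis by (simp add: mult.assoc[symmetric])
    qed
    then show ?thesis by (simp add: Suc del: of_nat_Suc binomial_Suc_Suc)
  qed
  finally have lower: "of_nat r * weighted_power_difference a s (Suc n) (r - 1) =
    (\<Sum>p=0..r. - (of_nat (r - p) * of_nat (r choose p) * (-1) ^ (r - p) * ?W p))"
    by (simp add: Suc)
  show ?thesis
    unfolding lower
    unfolding weighted_power_difference_def sum_distrib_left sum.distrib[symmetric]
    by (rule sum.cong[OF refl]) (simp add: weighted_power_sum_Suc of_nat_diff algebra_simps)
qed

text \<open>The identity \<open>(r choose p) (p choose j) = (r choose j) (r-j choose p-j)\<close> makes this a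
  difference of order \<open>r - j\<close>. For \<open>j < r\<close> the exponent \<open>r - j - 1\<close> is just too small to
  survive it.\<close>

lemma difference_of_power_factor:
  assumes "j \<le> r"
  shows "(\<Sum>p=0..r. of_nat (r choose p) * (-1) ^ (r - p) *
      (of_nat (p choose j) * power_factor s j p (int r - int j - 1))) = (if j = r then 1 else 0)"
    (is "sum ?f _ = _")
proof -
  have "sum ?f {0..r} = sum ?f {j..r}"
    by (rule sum.mono_neutral_right) auto
  also have "\<dots> = (\<Sum>i\<le>r - j. ?f (i + j))"
    using assms sum.shift_bounds_cl_nat_ivl[of ?f 0 j "r - j"] by (simp add: atLeast0AtMost)
  also have "\<dots> = (if j = r then 1 else 0)"
  proof (cases "j = r")
    case True
    then show ?thesis by (simp add: power_factor_diagonal_minus_1)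
  next
    case False
    define m where "m = r - j"
    have m: "r = m + j" "m > 0" using assms False by (auto simp: m_def)
    have e: "int r - int j - 1 = int (m - 1)" using m by auto
    have "?f (i + j) = of_nat (r choose j) * (s + of_nat j) * (-1) ^ m *
        (of_nat (m choose i) * (-1) ^ i * ((s + of_nat j) + of_nat i) ^ (m - 1))" if "i \<le> m" for i
    proof -
      have c: "of_nat (r choose (i + j)) * of_nat ((i + j) choose j) =
          (of_nat (r choose j) * of_nat (m choose i) :: 'a)"
        using choose_mult[of j "i + j" r] that m by (simp flip: of_nat_mult)
      have "(-1) ^ (r - (i + j)) = ((-1) ^ m * (-1) ^ i :: 'a)"
        using that m by (simp add: minus_one_power_iff)
      then have "?f (i + j) = (of_nat (r choose (i + j)) * of_nat ((i + j) choose j)) *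
          ((-1) ^ m * (-1) ^ i * ((s + of_nat j) * (of_nat (i + j) + s) ^ (m - 1)))"
        unfolding e power_factor_nonneg by (simp only: mult_ac)
      then show ?thesis unfolding c by (simp add: mult_ac add_ac)
    qed
    then have "(\<Sum>i\<le>r - j. ?f (i + j)) = of_nat (r choose j) * (s + of_nat j) * (-1) ^ m *
        (\<Sum>i\<le>m. of_nat (m choose i) * (-1) ^ i * ((s + of_nat j) + of_nat i) ^ (m - 1))"
      by (simp add: sum_distrib_left flip: m_def)
    then show ?thesis
      using alternating_binomial_sum_power_eq_0[of "m - 1" m "s + of_nat j"] m(2) False by simp
  qed
  finally show ?thesis .
qed

lemma weighted_power_difference_0: "weighted_power_difference a s 0 r = pochhammer a r"
proof -
  have "weighted_power_sum a s r p =
      (\<Sum>j=0..r. of_nat (p choose j) * pochhammer a j * power_factor s j p (int r - int j - 1))"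
    if "p \<le> r" for p
    unfolding weighted_power_sum_def by (rule sum.mono_neutral_left) (use that in auto)
  then have "weighted_power_difference a s 0 r =
      (\<Sum>p=0..r. \<Sum>j=0..r. pochhammer a j * (of_nat (r choose p) * (-1) ^ (r - p) *
        (of_nat (p choose j) * power_factor s j p (int r - int j - 1))))"
    by (simp add: weighted_power_difference_def sum_distrib_left mult_ac)
  also have "\<dots> = (\<Sum>j=0..r. pochhammer a j * (if j = r then 1 else 0))"
    by (subst sum.swap) (simp add: difference_of_power_factor flip: sum_distrib_left)
  also have "\<dots> = pochhammer a r" by (simp add: if_distrib cong: if_cong)
  finally show ?thesis .
qed

section \<open>Generating functions\<close>

unbundle fps_syntax

text \<open>The binomial series of \<open>(1 - x)\<^sup>c\<close>.\<close>

definition one_minus_power :: "'a::field_char_0 \<Rightarrow> 'a fps" where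
  "one_minus_power c = Abs_fps (\<lambda>k. (-1) ^ k * (c gchoose k))"

lemma one_minus_power_add_1: "one_minus_power (c + 1) = (1 - fps_X) * one_minus_power c"
proof (rule fps_ext)
  fix k
  show "one_minus_power (c + 1) $ k = ((1 - fps_X) * one_minus_power c) $ k"
    by (cases k) (simp_all add: one_minus_power_def left_diff_distrib gbinomial_Suc_Suc ring_distribs)
qed

lemma fps_deriv_one_minus_power:
  "(1 - fps_X) * fps_deriv (one_minus_power c) = - fps_const c * one_minus_power c"
proof -
  have "fps_deriv (one_minus_power c) = - fps_const c * one_minus_power (c - 1)"
  proof (rule fps_ext)
    fix k
    have "(-1) ^ Suc k * (of_nat (Suc k) * (c gchoose Suc k)) =
        (-1) ^ Suc k * (c * ((c - 1) gchoose k))"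
      by (simp only: gbinomial_absorption)
    then show "fps_deriv (one_minus_power c) $ k = (- fps_const c * one_minus_power (c - 1)) $ k"
      by (simp add: one_minus_power_def mult_ac flip: fps_const_neg del: of_nat_Suc)
  qed
  then show ?thesis
    using one_minus_power_add_1[of "c - 1"] by (simp add: mult_ac)
qed

definition eulerian2_gf :: "'a::field_char_0 \<Rightarrow> 'a \<Rightarrow> nat \<Rightarrow> 'a fps" where
  "eulerian2_gf s t n = Abs_fps (\<lambda>k. eulerian2 s t (int n) (int k))"

definition weighted_power_difference_egf :: "'a::field_char_0 \<Rightarrow> 'a \<Rightarrow> nat \<Rightarrow> 'a fps" where
  "weighted_power_difference_egf a s n = Abs_fps (\<lambda>r. weighted_power_difference a s n r / fact r)"

lemma eulerian2_gf_0: "eulerian2_gf s t 0 = 1"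
proof (rule fps_ext)
  fix k
  have "eulerian2 s t (-1) l = 0" for l by (subst eulerian2.simps) simp
  then have "eulerian2 s t 0 (int k) = (if k = 0 then 1 else 0)" by (subst eulerian2.simps) simp
  then show "eulerian2_gf s t 0 $ k = 1 $ k" by (simp add: eulerian2_gf_def)
qed

lemma eulerian2_gf_Suc:
  "eulerian2_gf s t (Suc n) = fps_X * (1 - fps_X) * fps_deriv (eulerian2_gf s t n) +
    (fps_const s + fps_const (2 * of_nat n + t) * fps_X) * eulerian2_gf s t n"
proof (rule fps_ext)
  fix k
  have neg: "eulerian2 s t m (-1) = 0" for m by (subst eulerian2.simps) simp
  have rec: "eulerian2 s t (int (Suc n)) (int k) = (of_nat k + s) * eulerian2 s t (int n) (int k) +
      (2 * of_nat n + 1 - of_nat k + t) * eulerian2 s t (int n) (int k - 1)"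
    by (subst eulerian2.simps) (simp add: algebra_simps)
  show "eulerian2_gf s t (Suc n) $ k = (fps_X * (1 - fps_X) * fps_deriv (eulerian2_gf s t n) +
    (fps_const s + fps_const (2 * of_nat n + t) * fps_X) * eulerian2_gf s t n) $ k"
  proof (cases k)
    case 0
    then show ?thesis
      using rec neg by (simp add: eulerian2_gf_def distrib_right mult.assoc)
  next
    case (Suc l)
    then show ?thesis
      using rec by (cases l)
        (simp_all add: eulerian2_gf_def distrib_right left_diff_distrib mult.assoc ring_distribs)
  qed
qed

lemma weighted_power_difference_egf_0:
  "one_minus_power a * weighted_power_difference_egf a s 0 = 1"
proof (rule fps_ext)
  fix k
  \<comment> \<open>The second factor is the binomial series of \<open>(1 - x)\<^sup>-\<^sup>a\<close>, since
    \<open>pochhammer a i / fact i = (-1)\<^sup>i (- a gchoose i)\<close>.\<close>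
  have "(\<Sum>i=0..k. (-1) ^ i * (a gchoose i) * (pochhammer a (k - i) / fact (k - i))) =
      (\<Sum>i=0..k. (-1) ^ k * ((a gchoose i) * ((- a) gchoose (k - i))))"
  proof (rule sum.cong[OF refl])
    fix i assume "i \<in> {0..k}"
    then have "(-1) ^ k = ((-1) ^ i * (-1) ^ (k - i) :: 'a)" by (simp flip: power_add)
    then show "(-1) ^ i * (a gchoose i) * (pochhammer a (k - i) / fact (k - i)) =
        (-1) ^ k * ((a gchoose i) * ((- a) gchoose (k - i)))"
      by (simp add: gbinomial_pochhammer[of "- a"])
  qed
  also have "\<dots> = (-1) ^ k * ((a + - a) gchoose k)"
    by (simp only: gbinomial_Vandermonde flip: sum_distrib_left)
  also have "\<dots> = (if k = 0 then 1 else 0)" by (cases k) auto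
  finally show "(one_minus_power a * weighted_power_difference_egf a s 0) $ k = 1 $ k"
    by (simp add: fps_mult_nth one_minus_power_def weighted_power_difference_egf_def
        weighted_power_difference_0)
qed

lemma weighted_power_difference_egf_Suc:
  "(1 - fps_X) * weighted_power_difference_egf a s (Suc n) =
    fps_X * fps_deriv (weighted_power_difference_egf a s n) +
    fps_const s * weighted_power_difference_egf a s n"
proof (rule fps_ext)
  fix r
  show "((1 - fps_X) * weighted_power_difference_egf a s (Suc n)) $ r =
    (fps_X * fps_deriv (weighted_power_difference_egf a s n) +
      fps_const s * weighted_power_difference_egf a s n) $ r"
  proof (cases r)
    case 0
    then show ?thesis
      using weighted_power_difference_Suc[of a s n 0]
      by (simp add: weighted_power_difference_egf_def left_diff_distrib)
  next
    case (Suc q)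
    let ?D = "weighted_power_difference a s"
    have "?D (Suc n) q / fact q = of_nat r * ?D (Suc n) q / fact r"
      by (simp add: Suc del: of_nat_Suc)
    then have "?D (Suc n) r / fact r - ?D (Suc n) q / fact q = (of_nat r + s) * ?D n r / fact r"
      using weighted_power_difference_Suc[of a s n r]
      by (simp only: Suc diff_Suc_1 add_divide_distrib) simp
    then show ?thesis
      by (simp add: weighted_power_difference_egf_def left_diff_distrib Suc ring_distribs
          add_divide_distrib del: of_nat_Suc fact_Suc)
  qed
qed

text \<open>The induction step is the product rule: the factor \<open>1 - x\<close> in front of \<open>F\<^sub>n'\<close>
  turns the derivative of \<open>(1 - x)\<^sup>c\<close> into \<open>- c (1 - x)\<^sup>c\<close>, and for \<open>c = s + t + 2 n\<close> this
  leaves of the coefficient \<open>s + (2 n + t) x\<close> exactly \<open>s (1 - x)\<close>.\<close>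

lemma eulerian2_gf_eq:
  "eulerian2_gf s t n =
    one_minus_power (s + t + 2 * of_nat n) * weighted_power_difference_egf (s + t) s n"
proof (induction n)
  case 0
  then show ?case by (simp add: eulerian2_gf_0 weighted_power_difference_egf_0)
next
  case (Suc n)
  define c where "c = s + t + 2 * of_nat n"
  define H where "H = one_minus_power c"
  define G where "G = weighted_power_difference_egf (s + t) s n"
  have coeff: "fps_const (2 * of_nat n + t) = fps_const c - fps_const s"
    by (simp only: fps_const_sub) (simp add: c_def add.commute)
  have dH: "(1 - fps_X) * fps_deriv H = - fps_const c * H"
    by (simp add: H_def fps_deriv_one_minus_power)
  have "eulerian2_gf s t (Suc n) = fps_X * (1 - fps_X) * fps_deriv (H * G) +
      (fps_const s + (fps_const c - fps_const s) * fps_X) * (H * G)"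
    unfolding eulerian2_gf_Suc Suc.IH coeff by (simp add: H_def G_def c_def)
  also have "\<dots> = fps_X * ((1 - fps_X) * fps_deriv H) * G + fps_X * (1 - fps_X) * H * fps_deriv G +
      (fps_const s + (fps_const c - fps_const s) * fps_X) * (H * G)"
    by (simp only: fps_deriv_mult) (simp only: ring_distribs mult_ac add_ac)
  also have "\<dots> = (1 - fps_X) * H * (fps_X * fps_deriv G + fps_const s * G)"
    unfolding dH by algebra
  also have "\<dots> = (1 - fps_X) * ((1 - fps_X) * H) * weighted_power_difference_egf (s + t) s (Suc n)"
    unfolding G_def weighted_power_difference_egf_Suc[symmetric] by (simp only: mult_ac)
  also have "(1 - fps_X) * ((1 - fps_X) * H) = one_minus_power (s + t + 2 * of_nat (Suc n))"
    unfolding H_def one_minus_power_add_1[symmetric] by (simp add: c_def algebra_simps)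
  finally show ?case .
qed

section \<open>The explicit formula\<close>

lemma gbinomial_eq_falling_factorial: "c gchoose k = falling_factorial c k / fact k"
  by (simp add: gbinomial_prod_rev falling_factorial_def atLeast0LessThan)

theorem theorem15:
  fixes s t :: "'a::field_char_0" and n k :: nat
  assumes "k \<le> n"
  shows "eulerian2 s t (int n) (int k) =
    1 / fact k *
      (\<Sum>r=0..k. of_nat (k choose r) * falling_factorial (s + t + 2 * of_nat n) (k - r) *
        (\<Sum>p=0..r. of_nat (r choose p) * (-1) ^ (k - p) *
          (\<Sum>j=0..p. of_nat (p choose j) * pochhammer (s + t) j *
            power_factor s j p (int n + int r - int j - 1))))"
proof -
  let ?c = "s + t + 2 * of_nat n"
  have "eulerian2 s t (int n) (int k) = eulerian2_gf s t n $ k"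
    by (simp add: eulerian2_gf_def)
  also have "\<dots> = (weighted_power_difference_egf (s + t) s n * one_minus_power ?c) $ k"
    by (simp only: eulerian2_gf_eq mult.commute)
  also have "\<dots> = (\<Sum>r=0..k. weighted_power_difference (s + t) s n r / fact r *
      ((-1) ^ (k - r) * (falling_factorial ?c (k - r) / fact (k - r))))"
    by (simp add: fps_mult_nth weighted_power_difference_egf_def one_minus_power_def
        gbinomial_eq_falling_factorial)
  also have "\<dots> = (\<Sum>r=0..k. 1 / fact k * (of_nat (k choose r) * falling_factorial ?c (k - r) *
      ((-1) ^ (k - r) * weighted_power_difference (s + t) s n r)))"
    by (rule sum.cong[OF refl]) (simp add: binomial_fact)
  also have "\<dots> = (\<Sum>r=0..k. 1 / fact k * (of_nat (k choose r) * falling_factorial ?c (k - r) *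
      (\<Sum>p=0..r. of_nat (r choose p) * (-1) ^ (k - p) * weighted_power_sum (s + t) s (n + r) p)))"
  proof (rule sum.cong[OF refl])
    fix r assume "r \<in> {0..k}"
    then have sign: "(-1) ^ (k - r) * (-1) ^ (r - p) = ((-1) ^ (k - p) :: 'a)" if "p \<le> r" for p
      using that by (simp flip: power_add)
    have "(-1) ^ (k - r) * weighted_power_difference (s + t) s n r =
        (\<Sum>p=0..r. of_nat (r choose p) * ((-1) ^ (k - r) * (-1) ^ (r - p)) *
          weighted_power_sum (s + t) s (n + r) p)"
      by (simp add: weighted_power_difference_def sum_distrib_left mult_ac)
    also have "\<dots> = (\<Sum>p=0..r. of_nat (r choose p) * (-1) ^ (k - p) *
          weighted_power_sum (s + t) s (n + r) p)"
      by (rule sum.cong[OF refl]) (simp add: sign)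
    finally show "1 / fact k * (of_nat (k choose r) * falling_factorial ?c (k - r) *
        ((-1) ^ (k - r) * weighted_power_difference (s + t) s n r)) =
      1 / fact k * (of_nat (k choose r) * falling_factorial ?c (k - r) *
        (\<Sum>p=0..r. of_nat (r choose p) * (-1) ^ (k - p) *
          weighted_power_sum (s + t) s (n + r) p))"
      by simp
  qed
  finally show ?thesis
    by (simp only: weighted_power_sum_def of_nat_add sum_distrib_left[symmetric])
qed

end
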